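(* Let $\mathbf{A}=(A;\wedge,\vee,\to,\neg,\top)$ be an F-algebra, and put $\Diamond x:=x\wedge\top$ and $\Diamond(\mathbf{A}):=(\Diamond[A];\wedge,\vee,\to,\top)$. Then $\mathbf{A}$ is isomorphic to an F-twist-algebra over $\Diamond(\mathbf{A})$, as witnessed by the map $\iota\colon\mathbf{A}\to\Diamond(\mathbf{A})\times\Diamond(\mathbf{A})$, $a\mapsto(\Diamond a,\Diamond\neg a)$.
   Context: A De Morgan lattice is a distributive lattice with a unary operation $\neg$ satisfying $\neg\neg a=a$ and $\neg(a\wedge b)=\neg a\vee\neg b$. A Kleene algebra is a De Morgan lattice (not necessarily bounded) satisfying $\neg a\wedge a\le\neg b\vee b$; it is centered, with center $\top$, if $\neg\top=\top$. An F-algebra is an algebra $(A;\wedge,\vee,\to,\neg,\top)$ of type $(2,2,2,1,0)$ such that $(A;\wedge,\vee,\neg,\top)$ is a centered Kleene algebra and, with $\Diamond x:=x\wedge\top$: (F1) $x\wedge y=x\wedge(x\to y)$; (F2) $x\to y\le(x\wedge y)\vee\top$; (F3) $(x\wedge y)\to z=x\to(y\to z)$; (F4) $\top\le x\to(y\to y)$; (F5) $\top\le((x\to y)\to x)\to x$; (F6) $\Diamond(x\to y)=\Diamond x\to\Diamond y$. $\Diamond(\mathbf{A})$ carries the operations of $\mathbf{A}$ restricted to $\Diamond[A]=\{a\wedge\top: a\in A\}$; it is a generalized Boolean algebra with greatest element $\top$. A generalized Boolean algebra is an algebra $(B;\wedge,\vee,\to,1)$ such that $(B;\wedge,\vee,1)$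 is a lattice with greatest element $1$, $x\wedge y\le z$ iff $y\le x\to z$, and $(x\to y)\to x=x$. For a generalized Boolean algebra $\mathbf{B}$, the full F-twist-algebra $\mathbf{B}^{\bowtie}$ has universe $\{(a_1,a_2)\in B\times B:a_1\vee a_2=1\}$ and operations $(x_1,x_2)\wedge(y_1,y_2):=(x_1\wedge y_1,x_2\vee y_2)$, $\neg(x_1,x_2):=(x_2,x_1)$, $\top:=(1,1)$, $(x_1,x_2)\to(y_1,y_2):=(x_1\to y_1,x_2\vee y_2)$, with $x\vee y:=\neg(\neg x\wedge\neg y)$. An F-twist-algebra over $\mathbf{B}$ is any subalgebra $\mathbf{C}\leqslant\mathbf{B}^{\bowtie}$ such that $\pi_1[C]=B$, where $\pi_1$ is the first projection. *)

theory Defs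
  imports Main
begin

text \<open>The field \<open>unit\<close> is the greatest element \<open>1\<close> of a generalized Boolean algebra, but only the
  center \<open>\<top>\<close> (in general not a greatest element) of an F-algebra.\<close>

record 'a gb_algebra =
  carrier :: "'a set"
  meet :: "'a \<Rightarrow> 'a \<Rightarrow> 'a" (infixl "\<sqinter>\<index>" 70)
  join :: "'a \<Rightarrow> 'a \<Rightarrow> 'a" (infixl "\<squnion>\<index>" 65)
  imp :: "'a \<Rightarrow> 'a \<Rightarrow> 'a" (infixr "\<rightarrow>\<index>" 60)
  unit :: 'a ("\<top>\<index>")

record 'a f_algebra = "'a gb_algebra" +
  neg :: "'a \<Rightarrow> 'a" ("\<sim>\<index> _" [81] 80)

definition le :: "('a, 'm) gb_algebra_scheme \<Rightarrow> 'a \<Rightarrow> 'a \<Rightarrow> bool" (infix "\<sqsubseteq>\<index>" 50)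
  where "x \<sqsubseteq>\<^bsub>L\<^esub> y \<longleftrightarrow> x \<sqinter>\<^bsub>L\<^esub> y = x"

locale lattice_algebra =
  fixes L :: "('a, 'm) gb_algebra_scheme" (structure)
  assumes meet_closed: "\<lbrakk>x \<in> carrier L; y \<in> carrier L\<rbrakk> \<Longrightarrow> x \<sqinter> y \<in> carrier L"
    and join_closed: "\<lbrakk>x \<in> carrier L; y \<in> carrier L\<rbrakk> \<Longrightarrow> x \<squnion> y \<in> carrier L"
    and meet_assoc: "\<lbrakk>x \<in> carrier L; y \<in> carrier L; z \<in> carrier L\<rbrakk> \<Longrightarrow> (x \<sqinter> y) \<sqinter> z = x \<sqinter> (y \<sqinter> z)"
    and join_assoc: "\<lbrakk>x \<in> carrier L; y \<in> carrier L; z \<in> carrier L\<rbrakk> \<Longrightarrow> (x \<squnion> y) \<squnion> z = x \<squnion> (y \<squnion> z)"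
    and meet_comm: "\<lbrakk>x \<in> carrier L; y \<in> carrier L\<rbrakk> \<Longrightarrow> x \<sqinter> y = y \<sqinter> x"
    and join_comm: "\<lbrakk>x \<in> carrier L; y \<in> carrier L\<rbrakk> \<Longrightarrow> x \<squnion> y = y \<squnion> x"
    and meet_absorb: "\<lbrakk>x \<in> carrier L; y \<in> carrier L\<rbrakk> \<Longrightarrow> x \<sqinter> (x \<squnion> y) = x"
    and join_absorb: "\<lbrakk>x \<in> carrier L; y \<in> carrier L\<rbrakk> \<Longrightarrow> x \<squnion> (x \<sqinter> y) = x"

locale generalized_boolean_algebra = lattice_algebra B
  for B :: "('a, 'm) gb_algebra_scheme" (structure) +
  assumes unit_closed: "\<top> \<in> carrier B"
    and imp_closed: "\<lbrakk>x \<in> carrier B; y \<in> carrier B\<rbrakk> \<Longrightarrow> x \<rightarrow> y \<in> carrier B"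
    and unit_greatest: "x \<in> carrier B \<Longrightarrow> x \<sqsubseteq> \<top>"
    and residuation: "\<lbrakk>x \<in> carrier B; y \<in> carrier B; z \<in> carrier B\<rbrakk>
      \<Longrightarrow> x \<sqinter> y \<sqsubseteq> z \<longleftrightarrow> y \<sqsubseteq> x \<rightarrow> z"
    and peirce: "\<lbrakk>x \<in> carrier B; y \<in> carrier B\<rbrakk> \<Longrightarrow> (x \<rightarrow> y) \<rightarrow> x = x"

locale de_morgan_lattice = lattice_algebra A
  for A :: "('a, 'm) f_algebra_scheme" (structure) +
  assumes distrib: "\<lbrakk>x \<in> carrier A; y \<in> carrier A; z \<in> carrier A\<rbrakk>
      \<Longrightarrow> x \<sqinter> (y \<squnion> z) = (x \<sqinter> y) \<squnion> (x \<sqinter> z)"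
    and neg_closed: "x \<in> carrier A \<Longrightarrow> \<sim> x \<in> carrier A"
    and neg_neg: "x \<in> carrier A \<Longrightarrow> \<sim> (\<sim> x) = x"
    and neg_meet: "\<lbrakk>x \<in> carrier A; y \<in> carrier A\<rbrakk> \<Longrightarrow> \<sim> (x \<sqinter> y) = \<sim> x \<squnion> \<sim> y"

locale kleene_algebra = de_morgan_lattice A
  for A :: "('a, 'm) f_algebra_scheme" (structure) +
  assumes kleene: "\<lbrakk>x \<in> carrier A; y \<in> carrier A\<rbrakk> \<Longrightarrow> \<sim> x \<sqinter> x \<sqsubseteq> \<sim> y \<squnion> y"

locale centered_kleene_algebra = kleene_algebra A
  for A :: "('a, 'm) f_algebra_scheme" (structure) +
  assumes center_closed: "\<top> \<in> carrier A"
    and neg_center: "\<sim> \<top> = \<top>"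

definition dia :: "('a, 'm) gb_algebra_scheme \<Rightarrow> 'a \<Rightarrow> 'a" ("\<diamond>\<index> _" [81] 80)
  where "\<diamond>\<^bsub>A\<^esub> x = x \<sqinter>\<^bsub>A\<^esub> \<top>\<^bsub>A\<^esub>"

locale F_algebra = centered_kleene_algebra A
  for A :: "('a, 'm) f_algebra_scheme" (structure) +
  assumes imp_closed: "\<lbrakk>x \<in> carrier A; y \<in> carrier A\<rbrakk> \<Longrightarrow> x \<rightarrow> y \<in> carrier A"
    and F1: "\<lbrakk>x \<in> carrier A; y \<in> carrier A\<rbrakk> \<Longrightarrow> x \<sqinter> y = x \<sqinter> (x \<rightarrow> y)"
    and F2: "\<lbrakk>x \<in> carrier A; y \<in> carrier A\<rbrakk> \<Longrightarrow> x \<rightarrow> y \<sqsubseteq> (x \<sqinter> y) \<squnion> \<top>"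
    and F3: "\<lbrakk>x \<in> carrier A; y \<in> carrier A; z \<in> carrier A\<rbrakk>
      \<Longrightarrow> (x \<sqinter> y) \<rightarrow> z = x \<rightarrow> (y \<rightarrow> z)"
    and F4: "\<lbrakk>x \<in> carrier A; y \<in> carrier A\<rbrakk> \<Longrightarrow> \<top> \<sqsubseteq> x \<rightarrow> (y \<rightarrow> y)"
    and F5: "\<lbrakk>x \<in> carrier A; y \<in> carrier A\<rbrakk> \<Longrightarrow> \<top> \<sqsubseteq> ((x \<rightarrow> y) \<rightarrow> x) \<rightarrow> x"
    and F6: "\<lbrakk>x \<in> carrier A; y \<in> carrier A\<rbrakk> \<Longrightarrow> \<diamond> (x \<rightarrow> y) = (\<diamond> x) \<rightarrow> (\<diamond> y)"

text \<open>The operations of \<open>Diamond A\<close> are those of \<open>A\<close>; closure of the smaller carrier under them is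
  not built in, but is part of \<open>generalized_boolean_algebra (Diamond A)\<close>.\<close>

definition Diamond :: "('a, 'm) f_algebra_scheme \<Rightarrow> 'a gb_algebra"
  where "Diamond A = \<lparr>carrier = (\<lambda>a. \<diamond>\<^bsub>A\<^esub> a) ` carrier A,
    meet = meet A, join = join A, imp = imp A, unit = \<top>\<^bsub>A\<^esub>\<rparr>"

definition twist_meet :: "('a, 'm) gb_algebra_scheme \<Rightarrow> 'a \<times> 'a \<Rightarrow> 'a \<times> 'a \<Rightarrow> 'a \<times> 'a"
  where "twist_meet B x y = (fst x \<sqinter>\<^bsub>B\<^esub> fst y, snd x \<squnion>\<^bsub>B\<^esub> snd y)"

definition twist_neg :: "'a \<times> 'a \<Rightarrow> 'a \<times> 'a"
  where "twist_neg x = (snd x, fst x)"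

definition full_twist :: "('a, 'm) gb_algebra_scheme \<Rightarrow> ('a \<times> 'a) f_algebra"
  where "full_twist B =
    \<lparr>carrier = {(a, b). a \<in> carrier B \<and> b \<in> carrier B \<and> a \<squnion>\<^bsub>B\<^esub> b = \<top>\<^bsub>B\<^esub>},
     meet = twist_meet B,
     join = (\<lambda>x y. twist_neg (twist_meet B (twist_neg x) (twist_neg y))),
     imp = (\<lambda>x y. (fst x \<rightarrow>\<^bsub>B\<^esub> fst y, snd x \<squnion>\<^bsub>B\<^esub> snd y)),
     unit = (\<top>\<^bsub>B\<^esub>, \<top>\<^bsub>B\<^esub>),
     neg = twist_neg\<rparr>"

definition f_hom :: "('a, 'm) f_algebra_scheme \<Rightarrow> ('b, 'n) f_algebra_scheme \<Rightarrow> ('a \<Rightarrow> 'b) set"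
  where "f_hom A C = {f. f ` carrier A \<subseteq> carrier C \<and>
    (\<forall>x\<in>carrier A. \<forall>y\<in>carrier A.
      f (x \<sqinter>\<^bsub>A\<^esub> y) = f x \<sqinter>\<^bsub>C\<^esub> f y \<and>
      f (x \<squnion>\<^bsub>A\<^esub> y) = f x \<squnion>\<^bsub>C\<^esub> f y \<and>
      f (x \<rightarrow>\<^bsub>A\<^esub> y) = f x \<rightarrow>\<^bsub>C\<^esub> f y) \<and>
    (\<forall>x\<in>carrier A. f (\<sim>\<^bsub>A\<^esub> x) = \<sim>\<^bsub>C\<^esub> (f x)) \<and>
    f \<top>\<^bsub>A\<^esub> = \<top>\<^bsub>C\<^esub>}"

definition f_iso :: "('a, 'm) f_algebra_scheme \<Rightarrow> ('b, 'n) f_algebra_scheme \<Rightarrow> ('a \<Rightarrow> 'b) set"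
  where "f_iso A C = {f \<in> f_hom A C. bij_betw f (carrier A) (carrier C)}"

definition subalgebra :: "('a, 'm) f_algebra_scheme \<Rightarrow> ('a, 'n) f_algebra_scheme \<Rightarrow> bool"
  where "subalgebra C T \<longleftrightarrow> carrier C \<subseteq> carrier T \<and>
    (\<forall>x\<in>carrier C. \<forall>y\<in>carrier C.
      x \<sqinter>\<^bsub>T\<^esub> y \<in> carrier C \<and> x \<sqinter>\<^bsub>C\<^esub> y = x \<sqinter>\<^bsub>T\<^esub> y \<and>
      x \<squnion>\<^bsub>T\<^esub> y \<in> carrier C \<and> x \<squnion>\<^bsub>C\<^esub> y = x \<squnion>\<^bsub>T\<^esub> y \<and>
      x \<rightarrow>\<^bsub>T\<^esub> y \<in> carrier C \<and> x \<rightarrow>\<^bsub>C\<^esub> y = x \<rightarrow>\<^bsub>T\<^esub> y) \<and>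
    (\<forall>x\<in>carrier C. \<sim>\<^bsub>T\<^esub> x \<in> carrier C \<and> \<sim>\<^bsub>C\<^esub> x = \<sim>\<^bsub>T\<^esub> x) \<and>
    \<top>\<^bsub>T\<^esub> \<in> carrier C \<and> \<top>\<^bsub>C\<^esub> = \<top>\<^bsub>T\<^esub>"

definition F_twist_algebra_over :: "('a, 'm) gb_algebra_scheme \<Rightarrow> ('a \<times> 'a, 'n) f_algebra_scheme \<Rightarrow> bool"
  where "F_twist_algebra_over B C \<longleftrightarrow>
    generalized_boolean_algebra B \<and> subalgebra C (full_twist B) \<and> fst ` carrier C = carrier B"

definition iota :: "('a, 'm) f_algebra_scheme \<Rightarrow> 'a \<Rightarrow> 'a \<times> 'a"
  where "iota A a = (\<diamond>\<^bsub>A\<^esub> a, \<diamond>\<^bsub>A\<^esub> (\<sim>\<^bsub>A\<^esub> a))"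

end

theory Submission
  imports Defs
begin

text \<open>
  The center \<open>\<top>\<close> splits an element \<open>a\<close> into its lower part \<open>a \<sqinter> \<top>\<close> and its upper part \<open>a \<squnion> \<top>\<close>, and in
  a distributive lattice these two parts determine \<open>a\<close>. The negation fixes \<open>\<top>\<close> and reverses the
  order, so the upper part can be recorded as its mirror image \<open>\<diamond> \<sim> a\<close> below \<open>\<top>\<close>. Hence \<open>iota\<close> is
  injective (\<open>iota_inj\<close>).

  On lower parts, \<open>\<diamond>\<close> commutes with meet and join by distributivity and with the implication by F6.
  Everything below \<open>\<top>\<close> is a generalized Boolean algebra: F3 and F4 give \<open>\<top> \<sqsubseteq> a \<rightarrow> b\<close> whenever
  \<open>a \<sqsubseteq> b\<close>, while F1 is modus ponens and lets one pass from \<open>\<top> \<sqsubseteq> a \<rightarrow> b\<close> back to \<open>a \<sqsubseteq> b\<close> when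
  \<open>a \<sqsubseteq> \<top>\<close>. Residuation follows from these two facts, and F5 yields Peirce's law
  (\<open>Diamond_generalized_boolean\<close>).

  On upper parts, F1 and F2 say that \<open>x \<rightarrow> y\<close> and \<open>x \<sqinter> y\<close> cannot be told apart (\<open>imp_join_center\<close>).
  After mirroring, this is the second coordinate \<open>x\<^sub>2 \<squnion> y\<^sub>2\<close> of the twist implication. The condition
  \<open>x\<^sub>1 \<squnion> x\<^sub>2 = 1\<close> on twist pairs is the Kleene inequality for \<open>\<top>\<close>, which puts \<open>\<top>\<close> below every
  \<open>\<sim> a \<squnion> a\<close>. So \<open>iota\<close> is a homomorphism into the full twist algebra, and its image is the
  required subalgebra.
\<close>

section \<open>Lattices and De Morgan lattices on a carrier\<close>

context lattice_algebra
begin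

lemma meet_idem: "x \<in> carrier L \<Longrightarrow> x \<sqinter> x = x"
  by (metis join_absorb meet_absorb meet_closed)

lemma le_iff_join:
  assumes "x \<in> carrier L" "y \<in> carrier L"
  shows "x \<sqsubseteq> y \<longleftrightarrow> x \<squnion> y = y"
  using assms unfolding le_def
  by (metis join_absorb join_comm meet_absorb meet_comm)

lemma le_antisym:
  "\<lbrakk>x \<in> carrier L; y \<in> carrier L; x \<sqsubseteq> y; y \<sqsubseteq> x\<rbrakk> \<Longrightarrow> x = y"
  unfolding le_def by (metis meet_comm)

lemma le_trans:
  "\<lbrakk>x \<in> carrier L; y \<in> carrier L; z \<in> carrier L; x \<sqsubseteq> y; y \<sqsubseteq> z\<rbrakk> \<Longrightarrow> x \<sqsubseteq> z"
  unfolding le_def by (metis meet_assoc)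

lemma meet_le2: "\<lbrakk>x \<in> carrier L; y \<in> carrier L\<rbrakk> \<Longrightarrow> x \<sqinter> y \<sqsubseteq> y"
  unfolding le_def by (simp add: meet_assoc meet_idem)

lemma join_ge1: "\<lbrakk>x \<in> carrier L; y \<in> carrier L\<rbrakk> \<Longrightarrow> x \<sqsubseteq> x \<squnion> y"
  unfolding le_def by (rule meet_absorb)

lemma join_ge2: "\<lbrakk>x \<in> carrier L; y \<in> carrier L\<rbrakk> \<Longrightarrow> y \<sqsubseteq> x \<squnion> y"
  by (metis join_comm join_ge1)

lemma join_least:
  "\<lbrakk>x \<in> carrier L; y \<in> carrier L; z \<in> carrier L; x \<sqsubseteq> z; y \<sqsubseteq> z\<rbrakk> \<Longrightarrow> x \<squnion> y \<sqsubseteq> z"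
  by (metis join_assoc join_closed le_iff_join)

end

context de_morgan_lattice
begin

lemma neg_join:
  assumes "x \<in> carrier A" "y \<in> carrier A"
  shows "\<sim> (x \<squnion> y) = \<sim> x \<sqinter> \<sim> y"
  using assms by (metis meet_closed neg_closed neg_meet neg_neg)

lemma distrib_right:
  assumes "x \<in> carrier A" "y \<in> carrier A" "z \<in> carrier A"
  shows "(x \<squnion> y) \<sqinter> z = (x \<sqinter> z) \<squnion> (y \<sqinter> z)"
  using assms by (metis distrib join_closed meet_comm)

lemma meet_join_cancel:
  assumes a: "a \<in> carrier A" and b: "b \<in> carrier A" and t: "t \<in> carrier A"
    and meet_eq: "a \<sqinter> t = b \<sqinter> t" and join_eq: "a \<squnion> t = b \<squnion> t"
  shows "a = b"
proof -
  have "a = a \<sqinter> (b \<squnion> t)"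
    using a t join_eq meet_absorb by metis
  also have "\<dots> = (b \<sqinter> a) \<squnion> (b \<sqinter> t)"
    using a b t meet_eq by (metis distrib meet_comm)
  also have "\<dots> = b \<sqinter> (a \<squnion> t)"
    using a b t by (metis distrib)
  also have "\<dots> = b"
    using b t join_eq meet_absorb by metis
  finally show ?thesis .
qed

end

section \<open>The two parts of an element of an F-algebra\<close>

context centered_kleene_algebra
begin

lemma dia_closed: "x \<in> carrier A \<Longrightarrow> \<diamond> x \<in> carrier A"
  by (simp add: dia_def meet_closed center_closed)

lemma dia_le_center: "x \<in> carrier A \<Longrightarrow> \<diamond> x \<sqsubseteq> \<top>"
  by (simp add: dia_def meet_le2 center_closed)

lemma dia_fixed: "x \<sqsubseteq> \<top> \<Longrightarrow> \<diamond> x = x"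
  by (simp add: dia_def le_def)

lemma dia_center: "\<diamond> \<top> = \<top>"
  by (simp add: dia_def meet_idem center_closed)

lemma dia_meet:
  assumes "x \<in> carrier A" "y \<in> carrier A"
  shows "\<diamond> (x \<sqinter> y) = \<diamond> x \<sqinter> \<diamond> y"
  using assms center_closed unfolding dia_def
  by (metis meet_assoc meet_closed meet_comm meet_idem)

lemma dia_join:
  assumes "x \<in> carrier A" "y \<in> carrier A"
  shows "\<diamond> (x \<squnion> y) = \<diamond> x \<squnion> \<diamond> y"
  using assms center_closed unfolding dia_def by (rule distrib_right)

text \<open>The second coordinate of \<open>iota\<close> is the mirror image of the upper part \<open>x \<squnion> \<top>\<close>.\<close>

lemma neg_dia_neg:
  assumes "x \<in> carrier A"
  shows "\<sim> (\<diamond> (\<sim> x)) = x \<squnion> \<top>"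
  using assms by (simp add: dia_def neg_meet neg_closed neg_neg neg_center center_closed)

lemma center_le_neg_join: "x \<in> carrier A \<Longrightarrow> \<top> \<sqsubseteq> \<sim> x \<squnion> x"
  using kleene[of \<top> x] by (simp add: center_closed neg_center meet_idem)

lemma dia_join_dia_neg:
  assumes "x \<in> carrier A"
  shows "\<diamond> x \<squnion> \<diamond> (\<sim> x) = \<top>"
proof -
  have "\<diamond> x \<squnion> \<diamond> (\<sim> x) = \<diamond> (\<sim> x \<squnion> x)"
    using assms by (simp add: dia_join neg_closed dia_closed join_comm)
  also have "\<dots> = \<top>"
    using center_le_neg_join[OF assms] assms
    by (simp add: dia_def le_def meet_comm center_closed join_closed neg_closed)
  finally show ?thesis .
qed

lemma iota_inj: "inj_on (iota A) (carrier A)"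
proof (rule inj_onI)
  fix a b
  assume a: "a \<in> carrier A" and b: "b \<in> carrier A" and eq: "iota A a = iota A b"
  have "a \<sqinter> \<top> = b \<sqinter> \<top>"
    using eq by (simp add: iota_def dia_def)
  moreover have "a \<squnion> \<top> = b \<squnion> \<top>"
    using eq neg_dia_neg[OF a] neg_dia_neg[OF b] by (simp add: iota_def)
  ultimately show "a = b"
    using a b center_closed by (rule meet_join_cancel[rotated 3])
qed

end

context F_algebra
begin

lemma imp_join_center:
  assumes x: "x \<in> carrier A" and y: "y \<in> carrier A"
  shows "(x \<rightarrow> y) \<squnion> \<top> = (x \<sqinter> y) \<squnion> \<top>"
proof (rule le_antisym)
  note closed = x y imp_closed meet_closed join_closed center_closed
  show "(x \<rightarrow> y) \<squnion> \<top> \<sqsubseteq> (x \<sqinter> y) \<squnion> \<top>"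
    by (rule join_least) (simp_all add: closed F2 join_ge2)
  have "x \<sqinter> y \<sqsubseteq> x \<rightarrow> y"
    using F1[OF x y] meet_le2[OF x imp_closed[OF x y]] by simp
  then have "x \<sqinter> y \<sqsubseteq> (x \<rightarrow> y) \<squnion> \<top>"
    by (rule le_trans[rotated 3]) (simp_all add: closed join_ge1)
  then show "(x \<sqinter> y) \<squnion> \<top> \<sqsubseteq> (x \<rightarrow> y) \<squnion> \<top>"
    by (intro join_least) (simp_all add: closed join_ge2)
qed (simp_all add: x y imp_closed meet_closed join_closed center_closed)

lemma dia_neg_imp:
  assumes x: "x \<in> carrier A" and y: "y \<in> carrier A"
  shows "\<diamond> (\<sim> (x \<rightarrow> y)) = \<diamond> (\<sim> x) \<squnion> \<diamond> (\<sim> y)"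
proof -
  have "\<diamond> (\<sim> (x \<rightarrow> y)) = \<sim> ((x \<rightarrow> y) \<squnion> \<top>)"
    using x y by (simp add: dia_def neg_join imp_closed center_closed neg_center)
  also have "\<dots> = \<sim> ((x \<sqinter> y) \<squnion> \<top>)"
    by (simp only: imp_join_center[OF x y])
  also have "\<dots> = \<diamond> (\<sim> x \<squnion> \<sim> y)"
    using x y by (simp add: dia_def neg_join neg_meet meet_closed center_closed neg_center)
  also have "\<dots> = \<diamond> (\<sim> x) \<squnion> \<diamond> (\<sim> y)"
    using x y by (simp add: dia_join neg_closed)
  finally show ?thesis .
qed

section \<open>The elements below the center\<close>

text \<open>Since \<open>x = x \<sqinter> y\<close>, currying (F3) turns \<open>x \<rightarrow> y\<close> into the \<open>x \<rightarrow> (y \<rightarrow> y)\<close> of F4.\<close>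

lemma center_le_imp:
  assumes x: "x \<in> carrier A" and y: "y \<in> carrier A" and "x \<sqsubseteq> y"
  shows "\<top> \<sqsubseteq> x \<rightarrow> y"
  using F3[OF x y y] F4[OF x y] \<open>x \<sqsubseteq> y\<close> by (simp add: le_def)

text \<open>Modus ponens: \<open>x \<sqsubseteq> \<top> \<sqsubseteq> x \<rightarrow> y\<close> gives \<open>x = x \<sqinter> (x \<rightarrow> y)\<close>, which is \<open>x \<sqinter> y\<close> by F1.\<close>

lemma le_if_center_le_imp:
  assumes x: "x \<in> carrier A" and y: "y \<in> carrier A"
    and "x \<sqsubseteq> \<top>" and "\<top> \<sqsubseteq> x \<rightarrow> y"
  shows "x \<sqsubseteq> y"
proof -
  have "x \<sqsubseteq> x \<rightarrow> y"
    using le_trans[OF x center_closed imp_closed[OF x y]] assms(3,4) by blast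
  then show ?thesis
    using F1[OF x y] by (simp add: le_def)
qed

lemma residuation_below_center:
  assumes x: "x \<in> carrier A" and y: "y \<in> carrier A" and z: "z \<in> carrier A"
    and "y \<sqsubseteq> \<top>"
  shows "x \<sqinter> y \<sqsubseteq> z \<longleftrightarrow> y \<sqsubseteq> x \<rightarrow> z"
proof
  assume "x \<sqinter> y \<sqsubseteq> z"
  then have "\<top> \<sqsubseteq> (y \<sqinter> x) \<rightarrow> z"
    using x y z by (simp add: center_le_imp meet_closed meet_comm)
  then have "\<top> \<sqsubseteq> y \<rightarrow> (x \<rightarrow> z)"
    using F3[OF y x z] by simp
  then show "y \<sqsubseteq> x \<rightarrow> z"
    using y imp_closed[OF x z] \<open>y \<sqsubseteq> \<top>\<close> le_if_center_le_imp by blast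
next
  assume "y \<sqsubseteq> x \<rightarrow> z"
  then have "x \<sqinter> y = x \<sqinter> (y \<sqinter> (x \<rightarrow> z))"
    by (simp add: le_def)
  also have "\<dots> = y \<sqinter> (x \<sqinter> (x \<rightarrow> z))"
    using x y z by (metis imp_closed meet_assoc meet_comm)
  also have "\<dots> = (y \<sqinter> x) \<sqinter> z"
    using F1[OF x z] x y z by (simp add: meet_assoc)
  finally show "x \<sqinter> y \<sqsubseteq> z"
    using x y z by (metis meet_closed meet_le2)
qed

lemma imp_le_center:
  assumes x: "x \<in> carrier A" and y: "y \<in> carrier A" and "x \<sqsubseteq> \<top>" and "y \<sqsubseteq> \<top>"
  shows "x \<rightarrow> y \<sqsubseteq> \<top>"
  using F6[OF x y] dia_le_center[OF imp_closed[OF x y]] assms(3,4) by (simp add: dia_fixed)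

lemma peirce_below_center:
  assumes x: "x \<in> carrier A" and y: "y \<in> carrier A" and xt: "x \<sqsubseteq> \<top>" and yt: "y \<sqsubseteq> \<top>"
  shows "(x \<rightarrow> y) \<rightarrow> x = x"
proof (rule le_antisym)
  note closed = x y imp_closed
  show "(x \<rightarrow> y) \<rightarrow> x \<sqsubseteq> x"
    by (rule le_if_center_le_imp) (simp_all add: closed F5 imp_le_center xt yt)
  show "x \<sqsubseteq> (x \<rightarrow> y) \<rightarrow> x"
    using residuation_below_center[of "x \<rightarrow> y" x x] by (simp add: closed xt meet_le2)
qed (simp_all add: x y imp_closed)

lemma carrier_Diamond: "carrier (Diamond A) = {x \<in> carrier A. x \<sqsubseteq> \<top>}"
  using dia_closed dia_le_center dia_fixed
  by (force simp: Diamond_def image_iff)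

lemma Diamond_generalized_boolean: "generalized_boolean_algebra (Diamond A)"
proof -
  have ops: "meet (Diamond A) = meet A" "join (Diamond A) = join A"
    "imp (Diamond A) = imp A" "unit (Diamond A) = \<top>"
    by (simp_all add: Diamond_def)
  have le_Diamond: "x \<sqsubseteq>\<^bsub>Diamond A\<^esub> y \<longleftrightarrow> x \<sqsubseteq> y" for x y
    by (simp add: le_def ops)
  have meet_below: "x \<sqinter> y \<sqsubseteq> \<top>" if "x \<in> carrier A" "y \<in> carrier A" "y \<sqsubseteq> \<top>" for x y
    using that le_trans[OF meet_closed _ center_closed] meet_le2 by blast
  have center_refl: "\<top> \<sqsubseteq> \<top>"
    by (simp add: le_def meet_idem center_closed)
  \<comment> \<open>Residuation as a rewrite rule would turn \<open>x \<sqinter> y \<sqsubseteq> \<top>\<close> into \<open>y \<sqsubseteq> x \<rightarrow> \<top>\<close>, so it may be applied only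
    after the closure conditions have been discharged.\<close>
  show ?thesis
    by unfold_locales
      (simp_all add: ops le_Diamond carrier_Diamond meet_closed join_closed meet_assoc join_assoc
        meet_absorb join_absorb imp_closed center_closed center_refl meet_below join_least
        imp_le_center peirce_below_center,
       simp_all add: meet_comm join_comm residuation_below_center)
qed

section \<open>The twist representation\<close>

lemma iota_hom: "iota A \<in> f_hom A (full_twist (Diamond A))"
proof -
  have "iota A x \<in> carrier (full_twist (Diamond A))" if "x \<in> carrier A" for x
    using that dia_join_dia_neg[OF that] neg_closed
    by (auto simp: iota_def full_twist_def Diamond_def)
  then show ?thesis
    by (auto simp: f_hom_def iota_def full_twist_def Diamond_def twist_meet_def twist_neg_def
        dia_meet dia_join F6 dia_neg_imp neg_meet neg_join neg_neg neg_closed neg_center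
        dia_center)
qed

end

lemma hom_image_subalgebra:
  fixes T :: "'b f_algebra"
  assumes "F_algebra A" and hom: "f \<in> f_hom A T"
  shows "subalgebra (T\<lparr>carrier := f ` carrier A\<rparr>) T"
proof -
  interpret F_algebra A by fact
  have image_ops:
    "f x \<sqinter>\<^bsub>T\<^esub> f y \<in> f ` carrier A" "f x \<squnion>\<^bsub>T\<^esub> f y \<in> f ` carrier A"
    "f x \<rightarrow>\<^bsub>T\<^esub> f y \<in> f ` carrier A" "\<sim>\<^bsub>T\<^esub> (f x) \<in> f ` carrier A"
    if "x \<in> carrier A" "y \<in> carrier A" for x y
    using hom that meet_closed[OF that] join_closed[OF that] imp_closed[OF that]
      neg_closed[OF that(1)]
    by (auto simp: f_hom_def image_iff) metis+
  moreover have "\<top>\<^bsub>T\<^esub> \<in> f ` carrier A"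
    using hom center_closed by (auto simp: f_hom_def image_iff) metis
  moreover have "f ` carrier A \<subseteq> carrier T"
    using hom by (simp add: f_hom_def)
  ultimately show ?thesis
    by (auto simp: subalgebra_def)
qed

theorem theorem34:
  fixes A :: "'a f_algebra"
  assumes "F_algebra A"
  shows "\<exists>C :: ('a \<times> 'a) f_algebra. F_twist_algebra_over (Diamond A) C \<and> iota A \<in> f_iso A C"
proof -
  interpret F_algebra A by fact
  let ?T = "full_twist (Diamond A)"
  let ?C = "?T\<lparr>carrier := iota A ` carrier A\<rparr>"
  have "fst ` carrier ?C = carrier (Diamond A)"
    by (simp add: image_image iota_def Diamond_def)
  then have "F_twist_algebra_over (Diamond A) ?C"
    using Diamond_generalized_boolean hom_image_subalgebra[OF assms iota_hom]
    by (simp add: F_twist_algebra_over_def)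
  moreover have "iota A \<in> f_iso A ?C"
    using iota_hom iota_inj by (auto simp: f_iso_def f_hom_def bij_betw_def)
  ultimately show ?thesis by blast
qed

end
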